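(* Let $X\neq\{0\}$ be a real linear space and let $Y$ be a real Banach space. Suppose that for every closed convex normal and generating cone $K \subset Y$ and every $K$-convex function $F : X \to Y$, the directional derivative $F'(0;h)$ exists for every $h \in X$, $h\neq 0$. Then $Y$ is not isomorphic to $c_0$.
   Context: A nonempty subset $K$ of a real normed space $Y$ is a cone if $\lambda K \subset K$ for every $\lambda \ge 0$ and $K+K\subset K$. Write $x \le_K y$ if $y-x\in K$. A cone $K$ is normal if there is $C>0$ such that $0\le_K x\le_K y$ implies $\|x\|\le C\|y\|$. A cone $K$ is generating in $Y$ if $Y=K-K$. A function $F:X\to Y$ is $K$-convex if $\lambda F(x)+(1-\lambda)F(y)-F(\lambda x+(1-\lambda)y)\in K$ for all $x,y\in X$ and all $\lambda\in[0,1]$. The directional derivative of $F$ at $x_0\in X$ in the direction $h\neq 0$ is $F'(x_0;h)=\lim_{t\downarrow 0}\frac{F(x_0+th)-F(x_0)}{t}$, the limit being taken in the norm of $Y$; it is said to exist if this limit exists in $Y$. $c_0$ is the Banach space of real sequences converging to $0$ with the supremum norm. "Isomorphic" means linearly homeomorphic. *)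

theory Defs
  imports "HOL-Analysis.Analysis"
begin

text \<open>The library's \<^const>\<open>cone\<close> only asks for closure under nonnegative scaling; in
  particular it admits the empty set and non-convex sets.\<close>

definition ordering_cone :: "'b::real_vector set \<Rightarrow> bool" where
  "ordering_cone K \<longleftrightarrow> K \<noteq> {} \<and> cone K \<and> (\<forall>x\<in>K. \<forall>y\<in>K. x + y \<in> K)"

definition cone_le :: "'b::real_vector set \<Rightarrow> 'b \<Rightarrow> 'b \<Rightarrow> bool" where
  "cone_le K x y \<longleftrightarrow> y - x \<in> K"

definition normal_cone :: "'b::real_normed_vector set \<Rightarrow> bool" where
  "normal_cone K \<longleftrightarrow>
     (\<exists>C>0. \<forall>x y. cone_le K 0 x \<and> cone_le K x y \<longrightarrow> norm x \<le> C * norm y)"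

definition generating_cone :: "'b::real_vector set \<Rightarrow> bool" where
  "generating_cone K \<longleftrightarrow> UNIV = {x - y | x y. x \<in> K \<and> y \<in> K}"

definition cone_convex :: "'b::real_vector set \<Rightarrow> ('a::real_vector \<Rightarrow> 'b) \<Rightarrow> bool" where
  "cone_convex K F \<longleftrightarrow>
     (\<forall>x y. \<forall>l\<in>{0..1}.
        l *\<^sub>R F x + (1 - l) *\<^sub>R F y - F (l *\<^sub>R x + (1 - l) *\<^sub>R y) \<in> K)"

definition has_dir_derivative ::
    "('a::real_vector \<Rightarrow> 'b::real_normed_vector) \<Rightarrow> 'a \<Rightarrow> 'a \<Rightarrow> 'b \<Rightarrow> bool" where
  "has_dir_derivative F x0 h d \<longleftrightarrow>
     ((\<lambda>t. (F (x0 + t *\<^sub>R h) - F x0) /\<^sub>R t) \<longlongrightarrow> d) (at_right 0)"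

text \<open>Since \<^typ>\<open>nat\<close> is discrete, \<^typ>\<open>nat \<Rightarrow>\<^sub>C real\<close> is the space of all bounded real
  sequences with the supremum norm, and $c_0$ is a closed subspace of it.\<close>

definition c0 :: "(nat \<Rightarrow>\<^sub>C real) set" where
  "c0 = {f. apply_bcontfun f \<longlonglongrightarrow> 0}"

lemma subspace_c0: "subspace c0"
  unfolding subspace_def c0_def
  by (auto intro: tendsto_add_zero tendsto_mult_right_zero)

lemma apply_bcontfun_c0: "apply_bcontfun ` c0 = {f. f \<longlonglongrightarrow> 0}"
proof (intro equalityI subsetI)
  fix f :: "nat \<Rightarrow> real" assume "f \<in> {f. f \<longlonglongrightarrow> 0}"
  then have lim: "f \<longlonglongrightarrow> 0" by simp
  then have "f \<in> bcontfun"
    by (auto simp: bcontfun_def convergent_imp_bounded)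
  then obtain g where "f = apply_bcontfun g" by (rule bcontfunE)
  with lim show "f \<in> apply_bcontfun ` c0" by (auto simp: c0_def)
qed (auto simp: c0_def)

definition isomorphic_to_c0 :: "'b::real_normed_vector itself \<Rightarrow> bool" where
  "isomorphic_to_c0 _ \<longleftrightarrow>
     (\<exists>(T :: 'b \<Rightarrow> (nat \<Rightarrow>\<^sub>C real)) S. linear T \<and> homeomorphism UNIV c0 T S)"

end

theory Submission
  imports Defs
begin

text \<open>\<open>c\<^sub>0\<close> is isomorphic to the space \<open>c\<close> of convergent sequences, whose cone of nonnegative
  sequences is closed, normal and has an order unit, but is not regular: the sequences
  \<open>max (1 - 1 / (n * t)) 0\<close> decrease as \<open>t\<close> decreases to \<open>0\<close> and tend to \<open>0\<close> in every coordinate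
  \<open>n\<close>, although each of them has limit \<open>1\<close>. They are the difference quotients at \<open>0\<close> of the convex
  map \<open>s \<mapsto> (max (s - 1 / n) 0)\<^sub>n\<close>, which is composed with a nonzero linear functional on \<open>X\<close>.\<close>

text \<open>Under the isomorphism of \<open>c\<^sub>0\<close> with \<open>c\<close> used here, the entry \<open>f 0\<close> is the limit of the
  convergent sequence, and \<open>c_coord f n\<close> is its entry with index \<open>n \<ge> 1\<close>.\<close>

definition c_coord :: "(nat \<Rightarrow>\<^sub>C real) \<Rightarrow> nat \<Rightarrow> real" where
  "c_coord f n = apply_bcontfun f n + (if n = 0 then 0 else apply_bcontfun f 0)"

lemma bounded_linear_c_coord: "bounded_linear (\<lambda>f. c_coord f n)"
proof (rule bounded_linear_intro)
  fix f
  show "norm (c_coord f n) \<le> norm f * 2"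
    using norm_bounded[of f n] norm_bounded[of f 0] by (auto simp: c_coord_def)
qed (auto simp: c_coord_def algebra_simps)

lemma c_coord_le_norm: "\<bar>c_coord f n\<bar> \<le> 2 * norm f"
  using norm_bounded[of f n] norm_bounded[of f 0] by (auto simp: c_coord_def)

text \<open>For \<open>n > 0\<close> the entry \<open>f n\<close> is a difference of two numbers in
  the interval from 0 to \<open>b\<close>, so nonnegativity avoids a factor 2.\<close>

lemma norm_le_c_coord:
  assumes "\<And>n. 0 \<le> c_coord f n" "\<And>n. c_coord f n \<le> b"
  shows "norm f \<le> b"
proof (rule norm_bound)
  fix n
  show "norm (apply_bcontfun f n) \<le> b"
    using assms[of n] assms[of 0] by (auto simp: c_coord_def split: if_splits)
qed

lemma c_coord_tendsto:
  assumes "f \<in> c0"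
  shows "c_coord f \<longlonglongrightarrow> c_coord f 0"
proof -
  have "(\<lambda>n. apply_bcontfun f n + apply_bcontfun f 0) \<longlonglongrightarrow> 0 + apply_bcontfun f 0"
    using assms by (intro tendsto_intros) (simp add: c0_def)
  moreover have "\<forall>\<^sub>F n in sequentially. apply_bcontfun f n + apply_bcontfun f 0 = c_coord f n"
    using eventually_gt_at_top[of 0] by eventually_elim (simp add: c_coord_def)
  moreover have "c_coord f 0 = 0 + apply_bcontfun f 0"
    by (simp add: c_coord_def)
  ultimately show ?thesis
    by (simp only: tendsto_cong)
qed

text \<open>Subtracting the limit \<open>g 0\<close> from all entries of positive index inverts
  \<open>c_coord\<close>.\<close>

lemma ex_c0_c_coord:
  assumes "g \<longlonglongrightarrow> g 0"
  shows "\<exists>f\<in>c0. c_coord f = g"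
proof -
  define f where "f n = g n - (if n = 0 then 0 else g 0)" for n
  have "(\<lambda>n. g n - g 0) \<longlonglongrightarrow> g 0 - g 0"
    by (intro tendsto_intros assms)
  moreover have "\<forall>\<^sub>F n in sequentially. g n - g 0 = f n"
    using eventually_gt_at_top[of 0] by eventually_elim (simp add: f_def)
  ultimately have "f \<longlonglongrightarrow> 0"
    by (simp add: tendsto_cong)
  then obtain F where "F \<in> c0" "f = apply_bcontfun F"
    using apply_bcontfun_c0 by blast
  then show ?thesis
    by (intro bexI[of _ F] ext) (simp_all add: c_coord_def f_def flip: \<open>f = apply_bcontfun F\<close>)
qed

text \<open>Continuity at 0 gives a bound by scaling. With two maps, the case \<open>f = id\<close>
  bounds \<open>T\<close>, and the case \<open>g = id\<close> bounds its inverse without linearity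
  of \<open>S\<close>.\<close>

lemma linear_norm_bound:
  assumes lin: "linear f" "linear g"
    and d: "d > 0" "\<And>x. norm (f x) < d \<Longrightarrow> norm (g x) < 1"
  shows "\<exists>B>0. \<forall>x. norm (g x) \<le> B * norm (f x)"
proof (intro exI[of _ "2 / d"] conjI allI)
  fix x
  have scaled: "c * norm (g x) < 1" if "c > 0" "c * norm (f x) < d" for c
    using d(2)[of "c *\<^sub>R x"] that by (simp add: linear_scale[OF lin(1)] linear_scale[OF lin(2)])
  show "norm (g x) \<le> 2 / d * norm (f x)"
  proof (cases "f x = 0")
    case True
    \<comment> \<open>Every positive multiple of \<open>x\<close> satisfies the smallness hypothesis
      here, so a nonzero \<open>g x\<close> could be scaled to norm 1.\<close>
    then have "g x = 0"
      using scaled[of "1 / norm (g x)"] d(1) by (cases "g x = 0") auto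
    then show ?thesis
      using True by simp
  next
    case False
    then show ?thesis
      using scaled[of "d / (2 * norm (f x))"] d(1) by (simp add: field_simps)
  qed
qed (use d in simp)

lemma linear_homeomorphism_bounds:
  assumes lin: "linear T" and hom: "homeomorphism UNIV C T S"
  shows "\<exists>A>0. \<forall>x. norm (T x) \<le> A * norm x" and "\<exists>B>0. \<forall>x. norm x \<le> B * norm (T x)"
proof -
  have T0: "T 0 = 0" and ST: "S (T x) = x" and TC: "T x \<in> C" for x
    using lin hom by (auto simp: linear_0 homeomorphism_def)
  have "continuous_on UNIV T"
    using hom by (simp add: homeomorphism_def)
  from this[unfolded continuous_on_iff, rule_format, OF UNIV_I zero_less_one]
  obtain d where "d > 0" "\<And>x. dist x 0 < d \<Longrightarrow> dist (T x) (T 0) < 1"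
    by blast
  then show "\<exists>A>0. \<forall>x. norm (T x) \<le> A * norm x"
    using linear_norm_bound[OF linear_id lin, of d] by (simp add: T0)
  have "continuous_on C S"
    using hom by (simp add: homeomorphism_def)
  from this[unfolded continuous_on_iff, rule_format, OF TC zero_less_one]
  obtain e where "e > 0" "\<And>z. z \<in> C \<Longrightarrow> dist z (T 0) < e \<Longrightarrow> dist (S z) (S (T 0)) < 1"
    by blast
  then have "e > 0" "norm (T x) < e \<Longrightarrow> norm x < 1" for x
    using TC[of x] ST[of x] ST[of 0] by (simp_all add: T0 dist_norm) metis
  then show "\<exists>B>0. \<forall>x. norm x \<le> B * norm (T x)"
    using linear_norm_bound[OF lin linear_id, of e] by simp
qed

lemma ex_linear_functional:
  fixes h :: "'a::real_vector"
  assumes "h \<noteq> 0"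
  shows "\<exists>\<phi> :: 'a \<Rightarrow> real. linear \<phi> \<and> \<phi> h = 1"
  using linear_independent_extend[of "{h}" "\<lambda>_. 1::real"] assms by (simp add: dependent_single)

lemma hinge_convex:
  fixes a b e l :: real
  assumes "0 \<le> l" "l \<le> 1"
  shows "max (l * a + (1 - l) * b - e) 0 \<le> l * max (a - e) 0 + (1 - l) * max (b - e) 0"
proof -
  have "l * (a - e) \<le> l * max (a - e) 0" "(1 - l) * (b - e) \<le> (1 - l) * max (b - e) 0"
    using assms by (auto intro!: mult_left_mono)
  moreover have "0 \<le> l * max (a - e) 0" "0 \<le> (1 - l) * max (b - e) 0"
    using assms by auto
  moreover have "l * a + (1 - l) * b - e = l * (a - e) + (1 - l) * (b - e)"
    by (simp add: algebra_simps)
  ultimately show ?thesis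
    by linarith
qed

theorem corollary5p2:
  assumes nontrivial: "\<exists>x::'x::real_vector. x \<noteq> 0"
    and dir_deriv: "\<And>(K :: 'y::banach set) (F :: 'x \<Rightarrow> 'y) (h :: 'x).
      \<lbrakk>ordering_cone K; closed K; convex K; normal_cone K; generating_cone K;
       cone_convex K F; h \<noteq> 0\<rbrakk>
      \<Longrightarrow> \<exists>d. has_dir_derivative F 0 h d"
  shows "\<not> isomorphic_to_c0 TYPE('y)"
proof
  assume "isomorphic_to_c0 TYPE('y)"
  then obtain T :: "'y \<Rightarrow> (nat \<Rightarrow>\<^sub>C real)" and S
    where lin: "linear T" and hom: "homeomorphism UNIV c0 T S"
    unfolding isomorphic_to_c0_def by blast
  obtain A where A: "A > 0" "\<And>y. norm (T y) \<le> A * norm y"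
    using linear_homeomorphism_bounds(1)[OF lin hom] by blast
  obtain B where B: "B > 0" "\<And>y. norm y \<le> B * norm (T y)"
    using linear_homeomorphism_bounds(2)[OF lin hom] by blast
  have blT: "bounded_linear T"
    using lin A(2)
    by (intro bounded_linear_intro[where K = A]) (auto simp: linear_add linear_scale mult.commute)
  \<comment> \<open>These are the coordinates of \<open>y\<close> carried over to the space of
    convergent sequences; \<open>p 0\<close> is the limit functional.\<close>
  define p where "p n y = c_coord (T y) n" for n y
  have blp: "bounded_linear (p n)" for n
    unfolding p_def by (rule bounded_linear_compose[OF bounded_linear_c_coord blT])
  note p_add = bounded_linear.linear[OF blp, THEN linear_add]
    and p_diff = bounded_linear.linear[OF blp, THEN linear_diff]
    and p_scale = bounded_linear.linear[OF blp, THEN linear_scale]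
  have ex_p: "\<exists>y. \<forall>n. p n y = g n" if g: "g \<longlonglongrightarrow> g 0" for g :: "nat \<Rightarrow> real"
  proof -
    obtain f where "f \<in> c0" "c_coord f = g"
      using ex_c0_c_coord[OF g] by blast
    moreover from \<open>f \<in> c0\<close> have "T (S f) = f"
      using hom by (simp add: homeomorphism_def)
    ultimately show ?thesis
      by (intro exI[of _ "S f"]) (auto simp: p_def)
  qed
  define K where "K = {y. \<forall>n. 0 \<le> p n y}"
  have scaleK: "c *\<^sub>R y \<in> K" if "y \<in> K" "c \<ge> 0" for c y
    using that by (simp add: K_def p_scale)
  have addK: "x + y \<in> K" if "x \<in> K" "y \<in> K" for x y
    using that by (simp add: K_def p_add)
  have "0 \<in> K"
    by (simp add: K_def p_def[symmetric] bounded_linear.linear[OF blp, THEN linear_0])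
  then have ord: "ordering_cone K"
    unfolding ordering_cone_def cone_def using scaleK addK by auto
  have "convex K"
    unfolding convex_def using scaleK addK by auto
  have "closed K"
    unfolding K_def
    by (intro closed_Collect_all closed_Collect_le continuous_intros
        linear_continuous_on[OF blp])
  have "normal_cone K"
    unfolding normal_cone_def cone_le_def
  proof (intro exI[of _ "B * (2 * A)"] conjI allI impI)
    fix x y assume "x - 0 \<in> K \<and> y - x \<in> K"
    then have "0 \<le> p n x" "p n x \<le> p n y" for n
      by (auto simp: K_def p_diff)
    \<comment> \<open>The factor 2 comes from \<open>c_coord\<close>; \<open>A\<close> and
      \<open>B\<close> transfer the estimate from sequences to \<open>'y\<close>.\<close>
    moreover have "p n y \<le> 2 * norm (T y)" for n
      unfolding p_def using c_coord_le_norm[of "T y" n] by simp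
    ultimately have "norm (T x) \<le> 2 * norm (T y)"
      unfolding p_def by (intro norm_le_c_coord) (auto intro: order_trans)
    also have "\<dots> \<le> 2 * A * norm y"
      using A(2)[of y] by simp
    finally have "B * norm (T x) \<le> B * (2 * A * norm y)"
      using B(1) by simp
    then show "norm x \<le> B * (2 * A) * norm y"
      using B(2)[of x] by (simp add: mult.assoc)
  qed (use A B in simp)
  have "generating_cone K"
  proof -
    \<comment> \<open>The order unit is the preimage of the constant sequence 1: coordinates are
      bounded, so a multiple of \<open>u\<close> lifts any \<open>y\<close> into
      \<open>K\<close>.\<close>
    obtain u where u: "\<And>n. p n u = 1"
      using ex_p[of "\<lambda>_. 1"] by auto
    have "\<exists>a b. y = a - b \<and> a \<in> K \<and> b \<in> K" for y
    proof (intro exI conjI)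
      let ?c = "2 * norm (T y)"
      show "y = (y + ?c *\<^sub>R u) - ?c *\<^sub>R u"
        by simp
      have "0 \<le> p n y + ?c" for n
        unfolding p_def using c_coord_le_norm[of "T y" n] by simp
      then show "y + ?c *\<^sub>R u \<in> K" "?c *\<^sub>R u \<in> K"
        by (simp_all add: K_def p_add p_scale u)
    qed
    then show ?thesis
      unfolding generating_cone_def by blast
  qed
  obtain h :: 'x where h: "h \<noteq> 0"
    using nontrivial by blast
  then obtain \<phi> :: "'x \<Rightarrow> real" where \<phi>: "linear \<phi>" "\<phi> h = 1"
    using ex_linear_functional by blast
  \<comment> \<open>For \<open>n = 0\<close> the convention \<open>1 / 0 = 0\<close> gives the limit of the sequence, as it should.\<close>
  have "\<exists>y. \<forall>n. p n y = max (s - 1 / real n) 0" for s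
  proof (rule ex_p)
    have "(\<lambda>n. max (s - 1 / real n) 0) \<longlonglongrightarrow> max (s - 0) 0"
      by (intro tendsto_intros lim_1_over_n)
    then show "(\<lambda>n. max (s - 1 / real n) 0) \<longlonglongrightarrow> max (s - 1 / real 0) 0"
      by simp
  qed
  then obtain G where G: "\<And>s n. p n (G s) = max (s - 1 / real n) 0"
    by metis
  define F where "F x = G (\<phi> x)" for x
  \<comment> \<open>Membership in \<open>K\<close> is tested coordinatewise, and each coordinate of
    \<open>F\<close> is a hinge function composed with the linear map \<open>\<phi>\<close>.\<close>
  have "cone_convex K F"
    unfolding cone_convex_def K_def F_def
    using hinge_convex
    by (auto simp: p_add p_diff p_scale G linear_add[OF \<phi>(1)] linear_scale[OF \<phi>(1)])
  then obtain d where d: "has_dir_derivative F 0 h d"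
    using dir_deriv ord \<open>closed K\<close> \<open>convex K\<close> \<open>normal_cone K\<close> \<open>generating_cone K\<close> h by blast
  define q where "q t = (F (0 + t *\<^sub>R h) - F 0) /\<^sub>R t" for t
  have q: "p n (q t) = max (t - 1 / real n) 0 / t" for n t
    by (simp add: q_def F_def p_scale p_diff G linear_0[OF \<phi>(1)] linear_scale[OF \<phi>(1)] \<phi>(2)
        divide_inverse mult.commute)
  \<comment> \<open>Norm convergence forces convergence of each coordinate, which determines every
    \<open>p n d\<close>.\<close>
  have lim: "((\<lambda>t. p n (q t)) \<longlongrightarrow> p n d) (at_right 0)" for n
    using d bounded_linear.tendsto[OF blp] unfolding has_dir_derivative_def q_def by blast
  have "p 0 d = 1"
  proof -
    have "\<forall>\<^sub>F t in at_right 0. p 0 (q t) = 1"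
      using eventually_at_right_less[of 0] by eventually_elim (simp add: q)
    then have "((\<lambda>t. p 0 (q t)) \<longlongrightarrow> 1) (at_right 0)"
      by (rule tendsto_eventually)
    then show ?thesis
      using lim tendsto_unique trivial_limit_at_right_real by blast
  qed
  \<comment> \<open>The hinge with index \<open>n\<close> stays at 0 as long as
    \<open>t < 1 / n\<close>.\<close>
  moreover have "p n d = 0" if "n > 0" for n
  proof -
    have "\<forall>\<^sub>F t in at_right 0. t \<in> {0<..<1 / real n}"
      using that by (intro eventually_at_right_real) simp
    then have "\<forall>\<^sub>F t in at_right 0. p n (q t) = 0"
      by eventually_elim (simp add: q)
    then have "((\<lambda>t. p n (q t)) \<longlongrightarrow> 0) (at_right 0)"
      by (rule tendsto_eventually)
    then show ?thesis
      using lim tendsto_unique trivial_limit_at_right_real by blast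
  qed
  then have "(\<lambda>n. p n d) \<longlonglongrightarrow> 0"
    by (intro tendsto_eventually eventually_sequentiallyI[of 1]) simp
  \<comment> \<open>Since \<open>T d\<close> lies in \<open>c0\<close>, coordinate 0 of
    \<open>d\<close> must be the limit of the others; but it is 1 and they vanish.\<close>
  moreover have "(\<lambda>n. p n d) \<longlonglongrightarrow> p 0 d"
    unfolding p_def using hom by (intro c_coord_tendsto) (auto simp: homeomorphism_def)
  ultimately show False
    using LIMSEQ_unique by fastforce
qed

end
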